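(* For all integers $k\le r$ with $k-1>1$ and every $n\ge 1$ there exists an ordered $r$-graph $H^r_n(k)$ with $rn$ vertices and at least one edge such that the following holds for every real $\alpha$ with $1\le\alpha<k-1\le r-1$: writing $e(H^r_n(k))=d\,n^{\alpha}$ (so $d>0$ may depend on $n$) and $a=\min\{1,k-1-\alpha\}>0$, $$e(H')=O\!\left(\frac{d\,m^{\alpha}}{n^{a}}\right)$$ for every interval $k$-partite subgraph $H'\subset H^r_n(k)$ with parts of size $m$.
   Context: An $r$-graph is a finite hypergraph all of whose edges have size $r$; $e(H)$ is the number of edges of $H$. An ordered $r$-graph is an $r$-graph with a linear ordering of its vertex set $V$. An interval in $V$ is a set of consecutive elements in the ordering; $A<B$ means $a<b$ for all $a\in A$, $b\in B$. An ordered $r$-graph $H$ is interval $k$-partite if for some $\ell\ge k$ there are intervals $I_1<I_2<\cdots<I_\ell$ (the parts) of the vertex set such that every edge of $H$ is contained in $I_1\cup\dots\cup I_\ell$ and has nonempty intersection with $I_j$ for each $1\le j\le \ell$. The implicit constant in $O(\cdot)$ depends only on $r,k,\alpha$, and not on $n$, $m$ or $H'$. *)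

theory Defs
  imports Complex_Main
begin

datatype 'a hypergraph = Hypergraph (verts: "'a set") (edges: "'a set set")

text \<open>The linear ordering of the vertex set is the one inherited from the vertex type.\<close>

definition ordered_rgraph :: "nat \<Rightarrow> 'a::linorder hypergraph \<Rightarrow> bool" where
  "ordered_rgraph r H \<longleftrightarrow>
     finite (verts H) \<and> (\<forall>e\<in>edges H. e \<subseteq> verts H \<and> card e = r)"

definition num_edges :: "'a hypergraph \<Rightarrow> nat" where
  "num_edges H = card (edges H)"

definition subgraph :: "'a hypergraph \<Rightarrow> 'a hypergraph \<Rightarrow> bool" where
  "subgraph H' H \<longleftrightarrow> verts H' \<subseteq> verts H \<and> edges H' \<subseteq> edges H"

definition interval_in :: "'a::linorder set \<Rightarrow> 'a set \<Rightarrow> bool" where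
  "interval_in V I \<longleftrightarrow>
     I \<subseteq> V \<and> (\<forall>x\<in>I. \<forall>y\<in>I. \<forall>z\<in>V. x \<le> z \<and> z \<le> y \<longrightarrow> z \<in> I)"

definition set_less :: "'a::linorder set \<Rightarrow> 'a set \<Rightarrow> bool" where
  "set_less A B \<longleftrightarrow> (\<forall>a\<in>A. \<forall>b\<in>B. a < b)"

text \<open>
  The list \<open>Is\<close> of parts may have any length \<open>\<ell> \<ge> k\<close>. The parts are intervals of the vertex
  set of \<open>H\<close> itself, which matters when \<open>H\<close> is a non-spanning subgraph of a larger hypergraph.
\<close>

definition interval_partite_with ::
    "nat \<Rightarrow> 'a::linorder hypergraph \<Rightarrow> 'a set list \<Rightarrow> bool" where
  "interval_partite_with k H Is \<longleftrightarrow>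
     k \<le> length Is \<and>
     (\<forall>I\<in>set Is. interval_in (verts H) I) \<and>
     sorted_wrt set_less Is \<and>
     (\<forall>e\<in>edges H. e \<subseteq> \<Union>(set Is) \<and> (\<forall>I\<in>set Is. e \<inter> I \<noteq> {}))"

definition interval_partite_size ::
    "nat \<Rightarrow> nat \<Rightarrow> 'a::linorder hypergraph \<Rightarrow> bool" where
  "interval_partite_size k m H \<longleftrightarrow>
     (\<exists>Is. interval_partite_with k H Is \<and> (\<forall>I\<in>set Is. card I = m))"

end

theory Submission
  imports Defs
begin

text \<open>
  An edge of \<open>H n\<close> is a run of \<open>r - k + 2\<close> consecutive vertices together with \<open>k - 2\<close> further
  vertices, each taken freely from its own interval of length \<open>n\<close>; there are \<open>n\<close> choices for each of
  these \<open>k - 1\<close> pieces. If such an edge meets at least \<open>k\<close> parts \<open>I\<^sub>1 < I\<^sub>2 < \<dots>\<close>, then the run is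
  split between two parts, so it contains the last element of some part, which leaves only boundedly
  many positions for it. Hence an interval \<open>k\<close>-partite subgraph with parts of size \<open>m\<close> has
  \<open>O(m\<^bsup>k-2\<^esup>)\<close> of the \<open>n\<^bsup>k-1\<^esup>\<close> edges, which implies the bound for every \<open>\<alpha>\<close> because \<open>1 \<le> m \<le> r n\<close>.
\<close>

section \<open>The hypergraph and its number of edges\<close>

definition tail_set :: "nat \<Rightarrow> nat \<Rightarrow> nat list \<Rightarrow> nat set" where
  "tail_set n s ts = (\<lambda>i. (s + i) * n + ts ! i) ` {..<length ts}"

text \<open>The block starts among the first \<open>n\<close> vertices and stays below
  \<open>s * n\<close>, while the tail uses the cells of length \<open>n\<close> from
  \<open>s * n\<close> on. Both pieces can thus be read off from the edge.\<close>

definition block_edge :: "nat \<Rightarrow> nat \<Rightarrow> nat \<times> nat list \<Rightarrow> nat set" where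
  "block_edge n s p = {fst p..<fst p + s} \<union> tail_set n s (snd p)"

definition block_params :: "nat \<Rightarrow> nat \<Rightarrow> (nat \<times> nat list) set" where
  "block_params n q = {..<n} \<times> {ts. set ts \<subseteq> {..<n} \<and> length ts = q}"

definition block_hypergraph :: "nat \<Rightarrow> nat \<Rightarrow> nat \<Rightarrow> nat hypergraph" where
  "block_hypergraph s q n =
     Hypergraph {..<(s + q) * n} (block_edge n s ` block_params n q)"

lemma finite_tail_set [simp]: "finite (tail_set n s ts)"
  by (simp add: tail_set_def)

lemma tail_set_position_inj:
  fixes n :: nat
  assumes "(s + i) * n + x = (s + j) * n + y" "x < n" "y < n"
  shows "i = j \<and> x = y"
proof -
  have "((s + i) * n + x) div n = s + i" "((s + j) * n + y) div n = s + j"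
    using assms(2,3) by auto
  with assms show ?thesis by simp
qed

lemma card_tail_set:
  assumes "set ts \<subseteq> {..<n}"
  shows "card (tail_set n s ts) = length ts"
proof -
  have "inj_on (\<lambda>i. (s + i) * n + ts ! i) {..<length ts}"
  proof (rule inj_onI)
    fix i j
    assume "i \<in> {..<length ts}" "j \<in> {..<length ts}"
      and eq: "(s + i) * n + ts ! i = (s + j) * n + ts ! j"
    then have "ts ! i < n" "ts ! j < n" using assms nth_mem by blast+
    with eq show "i = j" using tail_set_position_inj by blast
  qed
  then show ?thesis by (simp add: tail_set_def card_image)
qed

lemma tail_set_subset:
  assumes "set ts \<subseteq> {..<n}"
  shows "tail_set n s ts \<subseteq> {s * n..<(s + length ts) * n}"
proof
  fix x assume "x \<in> tail_set n s ts"
  then obtain i where i: "i < length ts" "x = (s + i) * n + ts ! i"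
    by (auto simp: tail_set_def)
  then have "ts ! i < n" using assms nth_mem by blast
  then have "x < (s + Suc i) * n" using i by simp
  also have "\<dots> \<le> (s + length ts) * n" using i by (intro mult_le_mono1) simp
  finally have "x < (s + length ts) * n" .
  moreover have "s * n \<le> x" using i by (simp add: algebra_simps)
  ultimately show "x \<in> {s * n..<(s + length ts) * n}" by simp
qed

lemma tail_set_inj:
  assumes "set ts \<subseteq> {..<n}" "set us \<subseteq> {..<n}" "length ts = length us"
    and "tail_set n s ts = tail_set n s us"
  shows "ts = us"
proof (rule nth_equalityI[OF assms(3)])
  fix i assume i: "i < length ts"
  then have "(s + i) * n + ts ! i \<in> tail_set n s us"
    using assms(4) by (auto simp: tail_set_def)
  then obtain j where j: "j < length us" "(s + i) * n + ts ! i = (s + j) * n + us ! j"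
    by (auto simp: tail_set_def)
  moreover have "ts ! i < n" "us ! j < n" using i j assms nth_mem by blast+
  ultimately show "ts ! i = us ! i" using tail_set_position_inj by blast
qed

text \<open>The last vertex is at most \<open>(n - 1) + (s - 1)\<close>, and
  \<open>n + s - 1 \<le> s * n\<close> because \<open>(n - 1) * (s - 1)\<close> is nonnegative;
  writing both numbers as successors makes this visible to arithmetic on naturals.\<close>

lemma block_subset:
  fixes b n s :: nat
  assumes "b < n" "0 < s"
  shows "{b..<b + s} \<subseteq> {..<s * n}"
proof -
  obtain n' s' where "n = Suc n'" "s = Suc s'"
    using assms by (metis Suc_pred gr0I not_less0)
  with assms show ?thesis by auto
qed

text \<open>Cutting an edge at \<open>s * n\<close> separates its block from its tail. Injectivity
  turns the edge count into a count of parameters.\<close>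

lemma inj_on_block_edge:
  assumes "0 < s"
  shows "inj_on (block_edge n s) (block_params n q)"
proof (rule inj_onI, clarify)
  fix b ts c us
  assume p: "(b, ts) \<in> block_params n q" "(c, us) \<in> block_params n q"
    and eq: "block_edge n s (b, ts) = block_edge n s (c, us)"
  have parts: "block_edge n s (x, xs) \<inter> {..<s * n} = {x..<x + s}"
    "block_edge n s (x, xs) - {..<s * n} = tail_set n s xs"
    if "(x, xs) \<in> block_params n q" for x xs
    using that block_subset[of x n s] assms tail_set_subset[of xs n s]
    by (fastforce simp: block_edge_def block_params_def)+
  have "{b..<b + s} = {c..<c + s}" "tail_set n s ts = tail_set n s us"
    using parts[OF p(1)] parts[OF p(2)] eq by auto
  \<comment> \<open>The block is nonempty since \<open>0 < s\<close>, so it determines its starting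
    point.\<close>
  moreover from this have "b = c"
    using assms by (metis atLeastLessThan_eq_iff less_add_same_cancel1)
  ultimately show "b = c \<and> ts = us"
    using assms p tail_set_inj[of ts n us s] by (auto simp: block_params_def)
qed

lemma num_edges_block_hypergraph:
  assumes "0 < s"
  shows "num_edges (block_hypergraph s q n) = n ^ Suc q"
proof -
  have "num_edges (block_hypergraph s q n) = card (block_params n q)"
    by (simp add: num_edges_def block_hypergraph_def card_image inj_on_block_edge[OF assms])
  then show ?thesis
    by (simp add: block_params_def card_cartesian_product card_lists_length_eq)
qed

lemma ordered_rgraph_block_hypergraph:
  assumes "0 < s"
  shows "ordered_rgraph (s + q) (block_hypergraph s q n)"
  unfolding ordered_rgraph_def
proof (intro conjI ballI)
  show "finite (verts (block_hypergraph s q n))" by (simp add: block_hypergraph_def)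
next
  fix e assume "e \<in> edges (block_hypergraph s q n)"
  then obtain b ts where e: "e = {b..<b + s} \<union> tail_set n s ts" "b < n"
    and ts: "set ts \<subseteq> {..<n}" "length ts = q"
    by (auto simp: block_hypergraph_def block_edge_def block_params_def)
  note b = block_subset[OF e(2) assms] and t = tail_set_subset[OF ts(1), of s]
  have "{..<s * n} \<subseteq> {..<(s + q) * n}" by simp
  moreover have "{s * n..<(s + q) * n} \<subseteq> {..<(s + q) * n}" by auto
  ultimately have "e \<subseteq> {..<(s + q) * n}"
    using b t unfolding e ts(2) by (intro Un_least) (rule subset_trans, assumption+)+
  then show "e \<subseteq> verts (block_hypergraph s q n)" by (simp add: block_hypergraph_def)
  have "{b..<b + s} \<inter> tail_set n s ts = {}" using b t by fastforce
  then show "card e = s + q"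
    unfolding e by (simp add: card_Un_disjoint card_tail_set ts)
qed

section \<open>Counting the edges of an interval partite subgraph\<close>

text \<open>Disjointness lets \<open>T\<close> meet at most \<open>card T\<close> members of
  \<open>P\<close>, so at least two members are reached by the block alone. A run of consecutive
  numbers covered by \<open>P\<close> can leave the lower of these two only by passing its
  maximum.\<close>

lemma block_contains_Max:
  fixes P :: "nat set set"
  assumes fin: "finite P" "\<And>I. I \<in> P \<Longrightarrow> finite I"
    and sep: "\<And>I J. I \<in> P \<Longrightarrow> J \<in> P \<Longrightarrow> I \<noteq> J \<Longrightarrow> set_less I J \<or> set_less J I"
    and T: "finite T" "card T + 2 \<le> card P"
    and cover: "{b..<b + s} \<subseteq> \<Union>P"
    and hit: "\<And>I. I \<in> P \<Longrightarrow> ({b..<b + s} \<union> T) \<inter> I \<noteq> {}"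
  shows "\<exists>I\<in>P. Max I \<in> {b..<b + s}"
proof -
  have disj: "I = J" if "x \<in> I" "x \<in> J" "I \<in> P" "J \<in> P" for x I J
    using sep that unfolding set_less_def by blast
  define Q where "Q = {I \<in> P. T \<inter> I \<noteq> {}}"
  \<comment> \<open>Each member met by \<open>T\<close> is the unique member containing some point
    of \<open>T\<close>, so \<open>T\<close> maps onto \<open>Q\<close>.\<close>
  have "Q \<subseteq> (\<lambda>x. THE I. I \<in> P \<and> x \<in> I) ` T"
  proof
    fix I assume "I \<in> Q"
    then obtain x where "x \<in> T" "x \<in> I" "I \<in> P" by (auto simp: Q_def)
    moreover from this have "(THE I. I \<in> P \<and> x \<in> I) = I"
      by (intro the_equality) (simp, elim conjE, rule disj)
    ultimately show "I \<in> (\<lambda>x. THE I. I \<in> P \<and> x \<in> I) ` T" by force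
  qed
  then have "card Q \<le> card T" using T(1) by (rule surj_card_le[rotated])
  moreover have "card (P - Q) = card P - card Q"
    by (rule card_Diff_subset) (use fin in \<open>auto simp: Q_def\<close>)
  ultimately have "2 \<le> card (P - Q)" using T(2) by linarith
  then obtain I J where IJ: "I \<in> P - Q" "J \<in> P - Q" "I \<noteq> J"
    by (metis One_nat_def card_le_Suc0_iff_eq fin(1) finite_Diff not_less_eq_eq numeral_2_eq_2)
  have "\<exists>I J. I \<in> P - Q \<and> J \<in> P - Q \<and> set_less I J"
    using sep[of I J] IJ by blast
  then obtain I J where IJ: "I \<in> P - Q" "J \<in> P - Q" "set_less I J" by blast
  have "{b..<b + s} \<inter> K \<noteq> {}" if "K \<in> P - Q" for K
    using hit[of K] that by (auto simp: Q_def)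
  then obtain x y where xy: "x \<in> {b..<b + s} \<inter> I" "y \<in> {b..<b + s} \<inter> J"
    using IJ(1,2) by blast
  \<comment> \<open>The last block vertex in \<open>I\<close>; its successor is still in the block,
    because the block also reaches \<open>y\<close> above it.\<close>
  define z where "z = Max ({b..<b + s} \<inter> I)"
  have z: "z \<in> {b..<b + s} \<inter> I" unfolding z_def by (rule Max_in) (use xy in auto)
  have "z < y" using IJ(3) z xy by (auto simp: set_less_def)
  then have z1: "Suc z \<in> {b..<b + s}" using z xy by auto
  have "Suc z \<notin> I"
  proof
    assume "Suc z \<in> I"
    then have "Suc z \<le> z" unfolding z_def using z1 z_def by (intro Max_ge) auto
    then show False by simp
  qed
  then obtain K where K: "K \<in> P" "Suc z \<in> K" "K \<noteq> I" using cover z1 by blast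
  \<comment> \<open>The point \<open>Suc z\<close> of \<open>K\<close> exceeds \<open>z\<close> in
    \<open>I\<close>, so \<open>K\<close> lies above \<open>I\<close>, and then no element of
    \<open>I\<close> can exceed \<open>z\<close>.\<close>
  have "\<not> set_less K I" using K z by (force simp: set_less_def)
  then have "set_less I K" using sep[of I K] K IJ by blast
  then have "w \<le> z" if "w \<in> I" for w using that K by (force simp: set_less_def)
  then have "Max I = z" using z IJ fin by (intro Max_eqI) auto
  then show ?thesis using z IJ by blast
qed

text \<open>An edge is determined by the start of its block and its set of \<open>q\<close> other
  vertices. The former is confined to a bounded window below the maximum of some part, so only the
  latter contributes a power of \<open>m\<close>.\<close>

lemma card_partite_block_edges_le:
  fixes P :: "nat set set" and E :: "nat set set"
  assumes fin: "finite P" "\<And>I. I \<in> P \<Longrightarrow> finite I" "\<And>I. I \<in> P \<Longrightarrow> card I = m"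
    and sep: "\<And>I J. I \<in> P \<Longrightarrow> J \<in> P \<Longrightarrow> I \<noteq> J \<Longrightarrow> set_less I J \<or> set_less J I"
    and cP: "q + 2 \<le> card P"
    and shape: "\<And>e. e \<in> E \<Longrightarrow> \<exists>b T. e = {b..<b + s} \<union> T \<and> finite T \<and> card T = q"
    and cover: "\<And>e. e \<in> E \<Longrightarrow> e \<subseteq> \<Union>P"
    and hit: "\<And>e I. e \<in> E \<Longrightarrow> I \<in> P \<Longrightarrow> e \<inter> I \<noteq> {}"
  shows "card E \<le> card P * (s + 1) * (card P * m) ^ q"
proof -
  \<comment> \<open>A block containing \<open>Max I\<close> starts at most \<open>s\<close> below
    it. Truncated subtraction only shortens a window near 0, so \<open>s + 1\<close> still bounds
    its size.\<close>
  define B where "B = (\<Union>I\<in>P. {Max I - s..Max I})"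
  define S where "S = {T. T \<subseteq> \<Union>P \<and> card T = q}"
  have finU: "finite (\<Union>P)" using fin by blast
  have sub: "E \<subseteq> (\<lambda>(b, T). {b..<b + s} \<union> T) ` (B \<times> S)"
  proof
    fix e assume e: "e \<in> E"
    then obtain b T where bT: "e = {b..<b + s} \<union> T" "finite T" "card T = q"
      using shape by blast
    have "\<exists>I\<in>P. Max I \<in> {b..<b + s}"
    proof (rule block_contains_Max[OF fin(1,2) sep bT(2)])
      show "card T + 2 \<le> card P" using cP bT(3) by simp
      show "{b..<b + s} \<subseteq> \<Union>P" using cover[OF e] bT(1) by simp
      show "({b..<b + s} \<union> T) \<inter> I \<noteq> {}" if "I \<in> P" for I using hit[OF e that] bT(1) by simp
    qed
    then obtain I where "I \<in> P" "b \<le> Max I" "Max I < b + s" by auto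
    then have "b \<in> B" unfolding B_def by force
    moreover have "T \<in> S" using bT cover[OF e] by (auto simp: S_def)
    ultimately show "e \<in> (\<lambda>(b, T). {b..<b + s} \<union> T) ` (B \<times> S)" using bT by force
  qed
  have finB: "finite B" unfolding B_def using fin(1) by simp
  have finS: "finite S" unfolding S_def using finU by simp
  have "card {Max I - s..Max I} \<le> s + 1" for I :: "nat set" by simp
  then have cB: "card B \<le> card P * (s + 1)" unfolding B_def
    using card_UN_le[OF fin(1), of "\<lambda>I. {Max I - s..Max I}"]
      sum_bounded_above[of P "\<lambda>I. card {Max I - s..Max I}" "s + 1"] by force
  have "card (\<Union>P) \<le> card P * m"
    using card_UN_le[OF fin(1), of id] fin(3) by simp
  \<comment> \<open>The binomial coefficient is at most the power when \<open>q\<close> does not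
    exceed the size of the union, and is zero otherwise.\<close>
  moreover have "card S \<le> card (\<Union>P) ^ q"
    unfolding S_def n_subsets[OF finU] by (cases "q \<le> card (\<Union>P)")
      (auto simp: binomial_le_pow binomial_eq_0)
  ultimately have cS: "card S \<le> (card P * m) ^ q"
    using power_mono[of "card (\<Union>P)" "card P * m" q] by linarith
  have "card E \<le> card (B \<times> S)" using finB finS sub by (intro surj_card_le) simp_all
  also have "\<dots> \<le> card P * (s + 1) * (card P * m) ^ q"
    unfolding card_cartesian_product using cB cS by (rule mult_le_mono)
  finally show ?thesis .
qed

text \<open>The number of parts is not fixed in advance, but one edge must meet all of these
  disjoint sets, so there are at most \<open>s + q\<close> of them. That edge also makes every part
  nonempty, which gives the lower bound on \<open>m\<close>.\<close>

lemma num_edges_partite_block_le: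
  assumes s: "0 < s" and sub: "subgraph H' (block_hypergraph s q n)"
    and part: "interval_partite_size (q + 2) m H'" and ne: "edges H' \<noteq> {}"
  shows "num_edges H' \<le> (s + q) * (s + 1) * ((s + q) * m) ^ q"
    and "1 \<le> m" and "m \<le> (s + q) * n"
proof -
  obtain Is where Is: "interval_partite_with (q + 2) H' Is" "\<forall>I\<in>set Is. card I = m"
    using part by (auto simp: interval_partite_size_def)
  have len: "q + 2 \<le> length Is" and ints: "\<And>I. I \<in> set Is \<Longrightarrow> I \<subseteq> verts H'"
    and srt: "sorted_wrt set_less Is"
    and cover: "\<And>e. e \<in> edges H' \<Longrightarrow> e \<subseteq> \<Union>(set Is)"
    and hit: "\<And>e I. e \<in> edges H' \<Longrightarrow> I \<in> set Is \<Longrightarrow> e \<inter> I \<noteq> {}"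
    using Is(1) by (auto simp: interval_partite_with_def interval_in_def)
  obtain e where e: "e \<in> edges H'" using ne by blast
  have nonempty: "I \<noteq> {}" if "I \<in> set Is" for I using hit[OF e that] by blast
  have vsub: "verts H' \<subseteq> {..<(s + q) * n}"
    and esub: "edges H' \<subseteq> edges (block_hypergraph s q n)"
    using sub by (auto simp: subgraph_def block_hypergraph_def)
  have fin: "finite I" if "I \<in> set Is" for I
    using finite_subset[OF subset_trans[OF ints[OF that] vsub]] by simp
  have less: "set_less (Is ! i) (Is ! j)" if "i < j" "j < length Is" for i j
    using srt that by (auto simp: sorted_wrt_iff_nth_less)
  have sep: "set_less I J \<or> set_less J I" if "I \<in> set Is" "J \<in> set Is" "I \<noteq> J" for I J
  proof -
    obtain i j where "i < length Is" "j < length Is" "I = Is ! i" "J = Is ! j"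
      using \<open>I \<in> set Is\<close> \<open>J \<in> set Is\<close> by (auto simp: in_set_conv_nth)
    with \<open>I \<noteq> J\<close> less[of i j] less[of j i] show ?thesis
      by (cases i j rule: linorder_cases) auto
  qed
  \<comment> \<open>A repeated part would precede itself, which only the empty set can do. Hence the
    length of the list is the number of parts.\<close>
  have "distinct Is"
    unfolding distinct_conv_nth
  proof (intro allI impI)
    have "Is ! i \<noteq> Is ! j" if "i < j" "j < length Is" for i j
      using less[OF that] nonempty[of "Is ! j"] that by (auto simp: set_less_def)
    then show "Is ! i \<noteq> Is ! j" if "i < length Is" "j < length Is" "i \<noteq> j" for i j
      using that by (metis linorder_neqE_nat)
  qed
  then have cP: "card (set Is) = length Is" by (rule distinct_card)
  have card_e: "card e = s + q"
    using ordered_rgraph_block_hypergraph[OF s, of q n] e esub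
    by (auto simp: ordered_rgraph_def)
  then have "finite e" using s card_ge_0_finite[of e] by simp
  have "set Is \<subseteq> (\<lambda>x. THE I. I \<in> set Is \<and> x \<in> I) ` e"
  proof
    fix I assume I: "I \<in> set Is"
    then obtain x where x: "x \<in> e" "x \<in> I" using hit[OF e] by blast
    have eq: "J = I" if "J \<in> set Is" "x \<in> J" for J
      using sep[OF that(1) I] that(2) x(2) by (auto simp: set_less_def)
    have "(THE I. I \<in> set Is \<and> x \<in> I) = I"
      using I x(2) by (intro the_equality) (simp, elim conjE, rule eq)
    then show "I \<in> (\<lambda>x. THE I. I \<in> set Is \<and> x \<in> I) ` e" using x by force
  qed
  then have "card (set Is) \<le> card e" using \<open>finite e\<close> by (rule surj_card_le[rotated])
  then have cle: "card (set Is) \<le> s + q" using card_e by simp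
  have "card (edges H') \<le> card (set Is) * (s + 1) * (card (set Is) * m) ^ q"
  proof (rule card_partite_block_edges_le)
    fix f assume "f \<in> edges H'"
    then obtain b ts where "f = {b..<b + s} \<union> tail_set n s ts" "set ts \<subseteq> {..<n}" "length ts = q"
      using esub by (force simp: block_hypergraph_def block_edge_def block_params_def)
    then show "\<exists>b T. f = {b..<b + s} \<union> T \<and> finite T \<and> card T = q"
      using card_tail_set[of ts n s] by (intro exI[of _ b] exI[of _ "tail_set n s ts"]) simp
    show "f \<subseteq> \<Union>(set Is)" using cover \<open>f \<in> edges H'\<close> .
    show "f \<inter> I \<noteq> {}" if "I \<in> set Is" for I using hit \<open>f \<in> edges H'\<close> that .
  next
    fix I J assume "I \<in> set Is" "J \<in> set Is" "I \<noteq> J"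
    then show "set_less I J \<or> set_less J I" by (rule sep)
  qed (use fin Is(2) len cP in simp_all)
  also have "\<dots> \<le> (s + q) * (s + 1) * ((s + q) * m) ^ q"
    using cle by (intro mult_le_mono power_mono) auto
  finally show "num_edges H' \<le> (s + q) * (s + 1) * ((s + q) * m) ^ q"
    by (simp add: num_edges_def)
  obtain I where I: "I \<in> set Is" using len by (cases Is) auto
  have "0 < card I" using fin[OF I] nonempty[OF I] by (simp add: card_gt_0_iff)
  then show "1 \<le> m" using Is(2) I by auto
  have "card I \<le> card {..<(s + q) * n}"
    using ints[OF I] vsub by (intro card_mono) auto
  then show "m \<le> (s + q) * n" using Is(2) I by simp
qed

section \<open>Comparison of exponents and conclusion\<close>

text \<open>The edge count forces \<open>d = n powr (q + 1 - \<alpha>)\<close>. Dividing by the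
  power of \<open>n\<close> in the denominator leaves \<open>n powr (q - \<alpha>)\<close> or 1,
  according to which term attains the minimum.\<close>

lemma power_le_density_bound:
  fixes \<alpha> :: real and m n q r :: nat
  assumes \<alpha>: "1 \<le> \<alpha>" and m: "1 \<le> m" "m \<le> r * n" and n: "1 \<le> n" and r: "1 \<le> r"
    and d: "real n ^ Suc q = d * real n powr \<alpha>"
  shows "real m ^ q \<le>
    real r ^ q * (d * real m powr \<alpha> / real n powr min 1 (real q + 1 - \<alpha>))"
proof -
  have d_eq: "d = real n powr (real q + 1 - \<alpha>)"
  proof -
    have "real n ^ Suc q = real n powr (real q + 1)"
      using n powr_realpow[of "real n" "Suc q"] by (simp add: add.commute)
    with d have "d = real n powr (real q + 1) / real n powr \<alpha>" using n
      by (simp add: eq_divide_eq)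
    then show ?thesis by (simp only: powr_diff)
  qed
  have mq: "real m ^ q = real m powr real q" using m by (simp add: powr_realpow)
  have rq: "real r ^ q = real r powr real q" using r by (simp add: powr_realpow)
  have r1: "1 \<le> real r ^ q" using r by simp
  show ?thesis
  proof (cases "\<alpha> \<le> real q")
    \<comment> \<open>The minimum is 1. The surplus factor \<open>m powr (q - \<alpha>)\<close> has
      a nonnegative exponent, so \<open>m \<le> r * n\<close> bounds it; enlarging the power of
      \<open>r\<close> to \<open>r ^ q\<close> removes \<open>\<alpha>\<close> from the
      constant.\<close>
    case True
    have "real m powr (real q - \<alpha>) \<le> (real r * real n) powr (real q - \<alpha>)"
      using True m(2) by (intro powr_mono2) (simp_all flip: of_nat_mult)
    also have "\<dots> = real r powr (real q - \<alpha>) * real n powr (real q - \<alpha>)"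
      by (simp add: powr_mult)
    also have "\<dots> \<le> real r ^ q * real n powr (real q - \<alpha>)"
      unfolding rq using r \<alpha> by (intro mult_right_mono powr_mono) auto
    finally have "real m powr (real q - \<alpha>) * real m powr \<alpha>
        \<le> real r ^ q * real n powr (real q - \<alpha>) * real m powr \<alpha>"
      by (intro mult_right_mono) auto
    moreover have "real m powr (real q - \<alpha>) * real m powr \<alpha> = real m ^ q"
      by (simp add: mq flip: powr_add)
    moreover have "d / real n powr min 1 (real q + 1 - \<alpha>) = real n powr (real q - \<alpha>)"
      using True n by (simp add: d_eq powr_diff powr_add)
    moreover have "d * real m powr \<alpha> / real n powr min 1 (real q + 1 - \<alpha>) =
        d / real n powr min 1 (real q + 1 - \<alpha>) * real m powr \<alpha>" by simp
    ultimately show ?thesis by (simp only: mult.assoc)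
  next
    \<comment> \<open>The minimum is \<open>q + 1 - \<alpha>\<close>, the exponent of
      \<open>d\<close>, so the powers of \<open>n\<close> cancel and \<open>1 \<le> m\<close>
      suffices.\<close>
    case False
    then have "real m ^ q \<le> real m powr \<alpha>" unfolding mq using m by (intro powr_mono) auto
    also have "\<dots> \<le> real r ^ q * real m powr \<alpha>"
      using r1 by (simp add: mult_le_cancel_right1)
    also have "d / real n powr min 1 (real q + 1 - \<alpha>) = 1" 
      using False n by (simp add: d_eq min_def)
    then have "real r ^ q * real m powr \<alpha> =
        real r ^ q * (d * real m powr \<alpha> / real n powr min 1 (real q + 1 - \<alpha>))"
      by (metis mult_1 times_divide_eq_left)
    finally show ?thesis .
  qed
qed

theorem mainTheorem9:
  fixes r k :: nat
  assumes "k \<le> r" and "1 < k - 1"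
  shows "\<exists>H :: nat \<Rightarrow> nat hypergraph.
    (\<forall>n\<ge>1. ordered_rgraph r (H n) \<and> card (verts (H n)) = r * n \<and> 1 \<le> num_edges (H n)) \<and>
    (\<forall>\<alpha>::real. 1 \<le> \<alpha> \<and> \<alpha> < real k - 1 \<longrightarrow>
      (\<exists>C>0. \<forall>n\<ge>1. \<forall>d a :: real. \<forall>m H'.
        real (num_edges (H n)) = d * real n powr \<alpha> \<longrightarrow>
        a = min 1 (real k - 1 - \<alpha>) \<longrightarrow>
        ordered_rgraph r H' \<longrightarrow> subgraph H' (H n) \<longrightarrow> interval_partite_size k m H' \<longrightarrow>
        real (num_edges H') \<le> C * (d * real m powr \<alpha> / real n powr a)))"
proof -
  \<comment> \<open>With \<open>k - 2\<close> vertices outside the block, any \<open>k\<close> parts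
    leave at least two to the block.\<close>
  define q where "q = k - 2"
  define s where "s = r - q"
  have k: "k = q + 2" and r: "s + q = r" and s: "0 < s"
    using assms by (auto simp: q_def s_def)
  define K where "K = real (r * (s + 1) * r ^ q)"
  have K: "0 < K" unfolding K_def of_nat_0_less_iff using s r by simp
  have bound: "real (num_edges H') \<le> K * real r ^ q * (d * real m powr \<alpha> / real n powr a)"
    if n: "1 \<le> n" and \<alpha>: "1 \<le> \<alpha>"
      and d: "real (num_edges (block_hypergraph s q n)) = d * real n powr \<alpha>"
      and a: "a = min 1 (real k - 1 - \<alpha>)"
      and H': "subgraph H' (block_hypergraph s q n)" "interval_partite_size k m H'"
    for n m :: nat and \<alpha> d a :: real and H'
  proof (cases "edges H' = {}")
    \<comment> \<open>Without an edge, nothing bounds the parts or \<open>m\<close>; the claim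
      reduces to the right-hand side being nonnegative, which follows from
      \<open>0 \<le> d\<close>.\<close>
    case True
    have "0 \<le> d * real n powr \<alpha>" unfolding d[symmetric] by simp
    then have "0 \<le> d" using n by (simp add: zero_le_mult_iff)
    with True K show ?thesis by (simp add: num_edges_def)
  next
    case False
    note le = num_edges_partite_block_le[OF s H'(1) H'(2)[unfolded k] False, unfolded r]
    have a': "a = min 1 (real q + 1 - \<alpha>)" using a k by simp
    have d': "real n ^ Suc q = d * real n powr \<alpha>"
      using d by (simp add: num_edges_block_hypergraph[OF s])
    have "real (num_edges H') \<le> real (r * (s + 1) * (r * m) ^ q)"
      using le(1) by (simp only: of_nat_le_iff)
    also have "\<dots> = K * real m ^ q" by (simp add: K_def power_mult_distrib)
    also have "\<dots> \<le> K * (real r ^ q * (d * real m powr \<alpha> / real n powr a))"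
      unfolding a' using K \<alpha> le(2,3) n d' r s
      by (intro mult_left_mono power_le_density_bound) auto
    finally show ?thesis by (simp only: mult.assoc)
  qed
  have "0 < K * real r ^ q" using K r s by simp
  moreover have "ordered_rgraph r (block_hypergraph s q n)"
    "card (verts (block_hypergraph s q n)) = r * n" for n
    using ordered_rgraph_block_hypergraph[OF s, of q n] r
    by (auto simp: block_hypergraph_def)
  moreover have "1 \<le> num_edges (block_hypergraph s q n)" if "1 \<le> n" for n
    using that by (simp add: num_edges_block_hypergraph[OF s])
  ultimately show ?thesis using bound by (intro exI[of _ "block_hypergraph s q"]) blast
qed

end
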